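(* Let $1/2<\gamma<1$. Then the function $H_\gamma(x)$ is infinitely differentiable in $(0,1)$. In particular, its derivative is given by $$H_\gamma'(x)=\frac1x\int_0^x (x-t)^{\gamma-1}\left\{\gamma h_\gamma'(t)+t\,h_\gamma''(t)\right\}dt,\qquad 0<x<1,$$ and it satisfies $$H_\gamma'(x)\sim\frac{\sin\gamma\pi}{\pi}\cdot\frac{\Gamma(\gamma+1)^2}{\Gamma(2\gamma)}\cdot\frac{2\gamma-1}{1-\gamma}\cdot x^{2\gamma-2}\qquad\text{as }x\to0+ .$$
   Context: For $1/2<\gamma<1$ and $0<t<1$ put $$h_\gamma(t)=\frac{\sin\gamma\pi}{\pi}\cdot\frac{\gamma}{1-\gamma}\cdot\frac{t^{\gamma}}{(1-t)^{2\gamma}+t^{2\gamma}-2t^{\gamma}(1-t)^{\gamma}\cos\gamma\pi}.$$ The function $H_\gamma$ is given by $$H_\gamma(x)=\int_0^x (x-t)^{\gamma-1}h_\gamma'(t)\,dt,\qquad 0<x<1,$$ and it satisfies $\int_0^x H_\gamma(y)\,dy=\int_0^x(x-t)^{\gamma-1}h_\gamma(t)\,dt$. (It is the distribution function on $(0,1)$ characterized by $\int_0^1(\lambda+x)^{1-\gamma}\,dH_\gamma(x)=\frac{\gamma}{(\lambda+1)^{\gamma}-\lambda^{\gamma}}$ for all $\lambda>0$.) For functions $f,g$ defined and nonvanishing on $(0,\varepsilon)$ for some $\varepsilon>0$, $f(x)\sim g(x)$ as $x\to0+$ means $\lim_{x\to0+}f(x)/g(x)=1$. $\Gamma$ is the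 Gamma function. *)

theory Defs
  imports "HOL-Analysis.Analysis" "HOL-Library.Landau_Symbols"
begin

definition h_gam :: "real \<Rightarrow> real \<Rightarrow> real" where
  "h_gam \<gamma> t =
     sin (\<gamma> * pi) / pi * (\<gamma> / (1 - \<gamma>)) *
     (t powr \<gamma> /
       ((1 - t) powr (2 * \<gamma>) + t powr (2 * \<gamma>)
         - 2 * t powr \<gamma> * (1 - t) powr \<gamma> * cos (\<gamma> * pi)))"

text \<open>Only the values for \<open>0 < x < 1\<close> are meaningful. The integral is a Lebesgue integral; the
  derivatives of \<^term>\<open>h_gam \<gamma>\<close> are singular at 0, so the domain is taken to be the open interval.\<close>

definition H_gam :: "real \<Rightarrow> real \<Rightarrow> real" where
  "H_gam \<gamma> x = (LBINT t:{0<..<x}. (x - t) powr (\<gamma> - 1) * deriv (h_gam \<gamma>) t)"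

text \<open>The set is meant to be open: \<^const>\<open>deriv\<close> of a function at a point then depends only on
  its values on the set.\<close>

definition infinitely_differentiable_on :: "(real \<Rightarrow> real) \<Rightarrow> real set \<Rightarrow> bool" where
  "infinitely_differentiable_on f S \<longleftrightarrow>
     (\<forall>n. \<forall>x\<in>S. (deriv ^^ n) f differentiable (at x))"

end

theory Submission
  imports Defs
begin

text \<open>Write \<open>C\<close> for \<open>sin (\<gamma> \<pi>) / \<pi> * (\<gamma> / (1 - \<gamma>))\<close>. The proof is the substitution \<open>t = x s\<close>
  followed by differentiation under the integral sign. It is convenient to differentiate
  with the Euler operator \<open>\<theta> f (t) = t * f' (t)\<close>, because \<open>\<theta>\<close> commutes with dilations
  and because it does not make singularities at \<open>0\<close> worse: \<open>\<theta> (t powr a) = a * t powr a\<close>.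

  The function \<open>h_gam \<gamma>\<close> is \<open>t powr \<gamma>\<close> times a function from a ring that is closed under \<open>\<theta>\<close>
  and whose members are continuous on \<open>[0, 1)\<close>, the point \<open>0\<close> included. Hence
  \<open>h' (t) = t powr (\<gamma> - 1) * p t\<close> with \<open>p\<close> in this ring and \<open>p 0 = C * \<gamma>\<close>
  (\<open>deriv_h_gam\<close>), and \<open>t = x s\<close> gives (\<open>abel_integral\<close>)
    \<open>H (x) = x powr (2 * \<gamma> - 1) * K p (x)\<close>, where
    \<open>K p (x) = \<integral> (s * (1 - s)) powr (\<gamma> - 1) * p (x * s) ds\<close> over \<open>0 < s < 1\<close>.
  The weight is integrable and does not depend on \<open>x\<close>, and \<open>\<theta> p\<close> is bounded on \<open>[0, b]\<close> for
  every \<open>b < 1\<close>, so dominated convergence gives \<open>(K p)' (x) = K (\<theta> p) (x) / x\<close>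
  (\<open>dilation_integral_derivative\<close>).

  Consequently \<open>x powr c * K p (x)\<close> has the derivative \<open>x powr (c - 1) * K (c * p + \<theta> p) (x)\<close>,
  which is of the same shape; iterating shows that \<open>H\<close> is smooth. With \<open>c = 2 * \<gamma> - 1\<close> and
  \<open>q = (2 * \<gamma> - 1) * p + \<theta> p\<close> this reads \<open>H' (x) = x powr (2 * \<gamma> - 2) * K q (x)\<close>. On the one
  hand, \<open>\<gamma> * h' (t) + t * h'' (t) = t powr (\<gamma> - 1) * q t\<close>, so undoing the substitution yields the
  integral formula for \<open>H'\<close>. On the other hand, \<open>K q\<close> is continuous at \<open>0\<close> with value
  \<open>q 0 * Beta \<gamma> \<gamma> = (2 * \<gamma> - 1) * C * \<gamma> * (Gamma \<gamma>)\<^sup>2 / Gamma (2 * \<gamma>)\<close>, because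
  \<open>\<theta> p\<close> vanishes at \<open>0\<close>; this is the constant in the asymptotic formula.\<close>

section \<open>A ring of functions closed under the Euler operator\<close>

text \<open>All generators are continuous on the half-open interval \<open>[0, 1)\<close> thanks to
  \<open>0 powr a = 0\<close>; only positive exponents are allowed in \<open>t powr a\<close> for this reason.
  Being generated by operations that \<open>\<theta>\<close> respects, the ring gives control of all iterates
  of \<open>\<theta>\<close> without a Leibniz formula for higher derivatives.\<close>

inductive_set euler_smooth :: "(real \<Rightarrow> real) set" where
  const: "(\<lambda>_. c) \<in> euler_smooth"
| powr: "a > 0 \<Longrightarrow> (\<lambda>t. t powr a) \<in> euler_smooth"
| one_minus_powr: "(\<lambda>t. (1 - t) powr a) \<in> euler_smooth"
| add: "f \<in> euler_smooth \<Longrightarrow> g \<in> euler_smooth \<Longrightarrow> (\<lambda>t. f t + g t) \<in> euler_smooth"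
| mult: "f \<in> euler_smooth \<Longrightarrow> g \<in> euler_smooth \<Longrightarrow> (\<lambda>t. f t * g t) \<in> euler_smooth"
| inverse: "f \<in> euler_smooth \<Longrightarrow> (\<And>t. t \<in> {0..<1} \<Longrightarrow> f t \<noteq> 0) \<Longrightarrow>
            (\<lambda>t. inverse (f t)) \<in> euler_smooth"

text \<open>The identity enters as \<open>t powr 1\<close>, which is \<open>\<bar>t\<bar>\<close> on the whole line.\<close>

lemma euler_smooth_id: "(\<lambda>t. \<bar>t\<bar>) \<in> euler_smooth"
  using euler_smooth.powr[of 1] by simp

text \<open>\<open>f'\<close> is \<open>\<theta> f\<close> on \<open>(0, 1)\<close>, extended continuously to \<open>0\<close>. The value there is \<open>0\<close> for every
  member of the ring, which is what makes the leading coefficient at \<open>0\<close> computable without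
  knowing \<open>f'\<close>.\<close>

definition euler_derivative :: "(real \<Rightarrow> real) \<Rightarrow> (real \<Rightarrow> real) \<Rightarrow> bool" where
  "euler_derivative f f' \<longleftrightarrow> f' \<in> euler_smooth \<and> f' 0 = 0 \<and>
     (\<forall>t\<in>{0<..<1}. (f has_real_derivative f' t / t) (at t))"

lemma euler_smooth_continuous: "f \<in> euler_smooth \<Longrightarrow> continuous_on {0..<1} f"
  by (induction rule: euler_smooth.induct)
    (auto intro!: continuous_intros continuous_on_powr' )

text \<open>Closure under \<open>\<theta>\<close>, from \<open>\<theta> (t powr a) = a * t powr a\<close>, the identity
  \<open>\<theta> ((1 - t) powr a) = - a * t * (1 - t) powr (a - 1)\<close>, and the sum, product and quotient rules.\<close>

lemma euler_smooth_derivative: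
  assumes "f \<in> euler_smooth"
  shows "\<exists>f'. euler_derivative f f'"
  using assms
proof induction
  case (const c)
  have "euler_derivative (\<lambda>_. c) (\<lambda>_. 0)"
    by (auto simp: euler_derivative_def intro: euler_smooth.const)
  then show ?case by blast
next
  case (powr a)
  have "((\<lambda>t. t powr a) has_real_derivative a * t powr a / t) (at t)" if "t \<in> {0<..<1}" for t
    using that by (auto intro!: derivative_eq_intros simp: powr_diff)
  then have "euler_derivative (\<lambda>t. t powr a) (\<lambda>t. a * t powr a)"
    using powr by (auto simp: euler_derivative_def intro: euler_smooth.intros)
  then show ?case by blast
next
  case (one_minus_powr a)
  have "((\<lambda>t. (1 - t) powr a) has_real_derivative - a * (\<bar>t\<bar> * (1 - t) powr (a - 1)) / t) (at t)"
    if "t \<in> {0<..<1}" for t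
    using that by (auto intro!: derivative_eq_intros)
  moreover have "(\<lambda>t. - a * (\<bar>t\<bar> * (1 - t) powr (a - 1))) \<in> euler_smooth"
    by (intro euler_smooth.const euler_smooth.mult euler_smooth.one_minus_powr euler_smooth_id)
  ultimately have "euler_derivative (\<lambda>t. (1 - t) powr a) (\<lambda>t. - a * (\<bar>t\<bar> * (1 - t) powr (a - 1)))"
    by (auto simp: euler_derivative_def)
  then show ?case by blast
next
  case (add f g)
  then obtain f' g' where "euler_derivative f f'" "euler_derivative g g'" by blast
  then have "euler_derivative (\<lambda>t. f t + g t) (\<lambda>t. f' t + g' t)"
    by (auto simp: euler_derivative_def add_divide_distrib
             intro!: euler_smooth.add derivative_intros)
  then show ?case by blast
next
  case (mult f g)
  then obtain f' g' where "euler_derivative f f'" "euler_derivative g g'" by blast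
  with mult.hyps have "euler_derivative (\<lambda>t. f t * g t) (\<lambda>t. f' t * g t + g' t * f t)"
    by (auto simp: euler_derivative_def add_divide_distrib
             intro!: euler_smooth.add euler_smooth.mult derivative_eq_intros)
  then show ?case by blast
next
  case (inverse f)
  then obtain f' where f': "euler_derivative f f'" by blast
  define g where "g = (\<lambda>t. - 1 * (f' t * (inverse (f t) * inverse (f t))))"
  have "g \<in> euler_smooth"
    unfolding g_def using f' inverse.hyps
    by (intro euler_smooth.const euler_smooth.mult euler_smooth.inverse)
      (auto simp: euler_derivative_def)
  moreover have "((\<lambda>t. inverse (f t)) has_real_derivative g t / t) (at t)"
    if "t \<in> {0<..<1}" for t
    using that f' inverse.hyps
    by (auto simp: euler_derivative_def g_def intro!: derivative_eq_intros)
  ultimately have "euler_derivative (\<lambda>t. inverse (f t)) g"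
    using f' by (auto simp: euler_derivative_def g_def)
  then show ?case by blast
qed

section \<open>Averages over dilations\<close>

definition dilation_integral :: "(real \<Rightarrow> real) \<Rightarrow> (real \<Rightarrow> real) \<Rightarrow> real \<Rightarrow> real" where
  "dilation_integral w p x = (LBINT s:{0..1}. w s * p (x * s))"

text \<open>Both the continuity and the derivative of the averages are tested along sequences, which
  reduces them to this instance of dominated convergence.\<close>

lemma weighted_integral_tendsto:
  fixes w :: "real \<Rightarrow> real"
  assumes w: "set_integrable lborel {0..1} w"
    and f: "\<And>n. continuous_on {0..1} (f n)" and F: "continuous_on {0..1} F"
    and bound: "\<And>n s. s \<in> {0..1} \<Longrightarrow> \<bar>f n s\<bar> \<le> M"
    and lim: "\<And>s. s \<in> {0..1} \<Longrightarrow> (\<lambda>n. f n s) \<longlonglongrightarrow> F s"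
  shows "(\<lambda>n. LBINT s:{0..1}. w s * f n s) \<longlonglongrightarrow> (LBINT s:{0..1}. w s * F s)"
proof -
  have wm: "(\<lambda>s. indicator {0..1} s *\<^sub>R w s) \<in> borel_measurable lborel"
    using w unfolding set_integrable_def by (rule borel_measurable_integrable)
  have meas: "(\<lambda>s. indicator {0..1} s *\<^sub>R (w s * g s)) \<in> borel_measurable lborel"
    if "continuous_on {0..1} g" for g :: "real \<Rightarrow> real"
  proof -
    have "(\<lambda>s. indicator {0..1} s *\<^sub>R g s) \<in> borel_measurable lborel"
      using borel_measurable_continuous_on_indicator[OF _ that] by simp
    with wm have "(\<lambda>s. (indicator {0..1} s *\<^sub>R w s) * (indicator {0..1} s *\<^sub>R g s)) \<in> borel_measurable lborel"
      by (rule borel_measurable_times)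
    also have "(\<lambda>s. (indicator {0..1} s *\<^sub>R w s) * (indicator {0..1} s *\<^sub>R g s)) =
        (\<lambda>s. indicator {0..1} s *\<^sub>R (w s * g s))"
      by (auto simp: indicator_def)
    finally show ?thesis .
  qed
  show ?thesis
    unfolding set_lebesgue_integral_def
  proof (rule integral_dominated_convergence[where w = "\<lambda>s. M * \<bar>indicator {0..1} s *\<^sub>R w s\<bar>"])
    show "integrable lborel (\<lambda>s. M * \<bar>indicator {0..1} s *\<^sub>R w s\<bar>)"
      using w unfolding set_integrable_def by (intro integrable_mult_right integrable_abs)
    show "AE s in lborel. (\<lambda>n. indicator {0..1} s *\<^sub>R (w s * f n s)) \<longlonglongrightarrow>
        indicator {0..1} s *\<^sub>R (w s * F s)"
      by (intro AE_I2) (auto simp: indicator_def intro!: tendsto_intros lim)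
    show "AE s in lborel. norm (indicator {0..1} s *\<^sub>R (w s * f n s))
        \<le> M * \<bar>indicator {0..1} s *\<^sub>R w s\<bar>" for n
      using bound[of _ n]
      by (intro AE_I2) (auto simp: indicator_def abs_mult mult.commute[of M] intro!: mult_left_mono)
  qed (intro meas f F)+
qed

lemma dilation_continuous:
  fixes p :: "real \<Rightarrow> real"
  assumes "continuous_on {0..<1} p" "0 \<le> x" "x < 1"
  shows "continuous_on {0..1} (\<lambda>s. p (x * s))"
proof (rule continuous_on_compose2[OF assms(1)])
  show "(\<lambda>s. x * s) ` {0..1} \<subseteq> {0..<1}"
  proof safe
    fix s :: real assume "s \<in> {0..1}"
    then show "x * s \<in> {0..<1}"
      using assms mult_left_le[of s x] by auto
  qed
qed (intro continuous_intros)

lemma bounded_below_one: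
  fixes p :: "real \<Rightarrow> real"
  assumes "continuous_on {0..<1} p" "b < 1"
  obtains M where "\<And>t. t \<in> {0..b} \<Longrightarrow> \<bar>p t\<bar> \<le> M"
proof -
  have "compact (p ` {0..b})"
    using assms by (intro compact_continuous_image continuous_on_subset[OF assms(1)]) auto
  then have "bounded (p ` {0..b})" by (rule compact_imp_bounded)
  then obtain M where "\<forall>t\<in>{0..b}. \<bar>p t\<bar> \<le> M" by (auto simp: bounded_iff)
  then show ?thesis using that by blast
qed

lemma dilation_in_interval:
  fixes x s b :: real
  assumes "x \<in> {0..b}" "s \<in> {0..1}"
  shows "x * s \<in> {0..b}"
  using assms mult_left_le[of s x] by auto

lemma dilation_integrable:
  fixes p :: "real \<Rightarrow> real"
  assumes w: "set_integrable lborel {0..1} w" and p: "continuous_on {0..<1} p"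
    and x: "0 \<le> x" "x < 1"
  shows "set_integrable lborel {0..1} (\<lambda>s. w s * p (x * s))"
proof -
  obtain M where M: "\<And>t. t \<in> {0..x} \<Longrightarrow> \<bar>p t\<bar> \<le> M"
    using bounded_below_one[OF p x(2)] by blast
  have wi: "integrable lborel (\<lambda>s. indicator {0..1} s *\<^sub>R w s)"
    using w unfolding set_integrable_def .
  have "integrable lborel (\<lambda>s. (indicator {0..1} s *\<^sub>R p (x * s)) * (indicator {0..1} s *\<^sub>R w s))"
  proof (rule Bochner_Integration.integrable_bound)
    show "integrable lborel (\<lambda>s. M * (indicator {0..1} s *\<^sub>R w s))"
      using wi by (intro integrable_mult_right)
    have "(\<lambda>s. indicator {0..1} s *\<^sub>R p (x * s)) \<in> borel_measurable lborel"
      using borel_measurable_continuous_on_indicator[OF _ dilation_continuous[OF p x]] by simp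
    then show "(\<lambda>s. (indicator {0..1} s *\<^sub>R p (x * s)) * (indicator {0..1} s *\<^sub>R w s))
        \<in> borel_measurable lborel"
      using borel_measurable_integrable[OF wi] by (rule borel_measurable_times)
    show "AE s in lborel. norm ((indicator {0..1} s *\<^sub>R p (x * s)) * (indicator {0..1} s *\<^sub>R w s))
        \<le> norm (M * (indicator {0..1} s *\<^sub>R w s))"
    proof (intro AE_I2)
      fix s :: real
      have "\<bar>p (x * s)\<bar> \<le> \<bar>M\<bar>" if "s \<in> {0..1}"
        using M[OF dilation_in_interval[of x x s]] that x by auto
      then show "norm ((indicator {0..1} s *\<^sub>R p (x * s)) * (indicator {0..1} s *\<^sub>R w s))
          \<le> norm (M * (indicator {0..1} s *\<^sub>R w s))"
        by (auto simp: indicator_def abs_mult intro!: mult_right_mono)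
    qed
  qed
  also have "(\<lambda>s. (indicator {0..1} s *\<^sub>R p (x * s)) * (indicator {0..1} s *\<^sub>R w s)) =
      (\<lambda>s. indicator {0..1} s *\<^sub>R (w s * p (x * s)))"
    by (auto simp: indicator_def)
  finally show ?thesis unfolding set_integrable_def .
qed

lemma dilation_integral_linear:
  assumes "set_integrable lborel {0..1} w" "continuous_on {0..<1} p" "continuous_on {0..<1} q"
    and "0 \<le> x" "x < 1"
  shows "dilation_integral w (\<lambda>t. c * p t + q t) x =
    c * dilation_integral w p x + dilation_integral w q x"
proof -
  have "dilation_integral w (\<lambda>t. c * p t + q t) x =
      (LBINT s:{0..1}. c * (w s * p (x * s)) + w s * q (x * s))"
    unfolding dilation_integral_def by (simp add: algebra_simps)
  also have "\<dots> = (LBINT s:{0..1}. c * (w s * p (x * s))) + (LBINT s:{0..1}. w s * q (x * s))"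
    using assms by (intro set_integral_add set_integrable_mult_right dilation_integrable)
  finally show ?thesis by (simp add: dilation_integral_def)
qed

text \<open>Including the left end point \<open>0\<close>, where the asymptotic behaviour is read off.\<close>

lemma dilation_integral_continuous:
  assumes w: "set_integrable lborel {0..1} w" and p: "continuous_on {0..<1} p" and b: "b < 1"
  shows "continuous_on {0..b} (dilation_integral w p)"
  unfolding continuous_on tendsto_at_iff_sequentially
proof safe
  fix x and X :: "nat \<Rightarrow> real"
  assume x: "x \<in> {0..b}" and X: "\<forall>i. X i \<in> {0..b} - {x}" and lim: "X \<longlonglongrightarrow> x"
  obtain M where M: "\<And>t. t \<in> {0..b} \<Longrightarrow> \<bar>p t\<bar> \<le> M"
    using bounded_below_one[OF p b] by blast
  show "(dilation_integral w p \<circ> X) \<longlonglongrightarrow> dilation_integral w p x"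
    unfolding comp_def dilation_integral_def
  proof (rule weighted_integral_tendsto[OF w, where M = M])
    show "continuous_on {0..1} (\<lambda>s. p (X n * s))" for n
      using X b by (intro dilation_continuous[OF p]) (auto dest: spec[of _ n])
    show "continuous_on {0..1} (\<lambda>s. p (x * s))"
      using x b by (intro dilation_continuous[OF p]) auto
    show "\<bar>p (X n * s)\<bar> \<le> M" if "s \<in> {0..1}" for n s
      using X that by (intro M dilation_in_interval) auto
    fix s :: real assume s: "s \<in> {0..1}"
    have "continuous_on {0..b} p" using b by (intro continuous_on_subset[OF p]) auto
    then show "(\<lambda>n. p (X n * s)) \<longlonglongrightarrow> p (x * s)"
    proof (rule continuous_on_tendsto_compose)
      show "x * s \<in> {0..b}" using x s by (rule dilation_in_interval)
      show "\<forall>\<^sub>F n in sequentially. X n * s \<in> {0..b}"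
        using X s by (intro always_eventually allI dilation_in_interval) auto
    qed (intro tendsto_intros lim)
  qed
qed

text \<open>Since \<open>d/dy p (y * s) = q (y * s) / y\<close> for \<open>q = \<theta> p\<close>, and \<open>q\<close> is bounded on \<open>[0, b]\<close>, the
  difference quotients of \<open>p (y * s)\<close> in \<open>y\<close> are bounded uniformly in \<open>s\<close> as long as \<open>y\<close> stays
  in a compact part of \<open>(0, 1)\<close>. The condition \<open>q 0 = 0\<close> makes the same formula true for \<open>s = 0\<close>,
  where \<open>p (y * s)\<close> is constant.\<close>

lemma dilation_integral_derivative:
  assumes w: "set_integrable lborel {0..1} w" and p: "continuous_on {0..<1} p"
    and q: "continuous_on {0..<1} q" "q 0 = 0"
    and deriv: "\<And>t. t \<in> {0<..<1} \<Longrightarrow> (p has_real_derivative q t / t) (at t)"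
    and x: "x \<in> {0<..<1}"
  shows "(dilation_integral w p has_real_derivative dilation_integral w q x / x) (at x)"
proof -
  define a where "a = x / 2"
  define b where "b = (1 + x) / 2"
  have ab: "0 < a" "a < x" "x < b" "b < 1" using x by (auto simp: a_def b_def)
  obtain M where M: "\<And>t. t \<in> {0..b} \<Longrightarrow> \<bar>q t\<bar> \<le> M"
    using bounded_below_one[OF q(1) ab(4)] by blast
  have M0: "0 \<le> M" using M[of 0] ab by auto
  have pderiv: "((\<lambda>y. p (y * s)) has_real_derivative q (y * s) / y) (at y)"
    if "s \<in> {0..1}" "y \<in> {a<..<b}" for s y
  proof (cases "s = 0")
    case True
    then show ?thesis using q by simp
  next
    case False
    with that ab have "0 < y * s" by simp
    moreover have "y * s \<le> b" using dilation_in_interval[of y b s] that ab by auto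
    ultimately have "y * s \<in> {0<..<1}" using ab by auto
    from DERIV_chain2[where g = "\<lambda>y. y * s", OF deriv[OF this] DERIV_cmult_right[OF DERIV_ident]]
    show ?thesis
      using False by simp
  qed
  have dq: "\<bar>q (y * s) / y\<bar> \<le> M / a" if "s \<in> {0..1}" "y \<in> {a<..<b}" for s y
    using M[OF dilation_in_interval[of y b s]] that ab M0
    by (auto simp: abs_div intro!: frac_le)
  have "((\<lambda>y. (dilation_integral w p y - dilation_integral w p x) / (y - x)) \<longlongrightarrow>
      dilation_integral w q x / x) (at x within {a<..<b})"
    unfolding tendsto_at_iff_sequentially
  proof safe
    fix X :: "nat \<Rightarrow> real"
    assume X: "\<forall>i. X i \<in> {a<..<b} - {x}" and lim: "X \<longlonglongrightarrow> x"
    have Xn: "0 \<le> X n" "X n < 1" "X n \<in> {a<..<b}" "X n \<noteq> x" for n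
      using X[rule_format, of n] ab by auto
    have "(\<lambda>n. LBINT s:{0..1}. w s * ((p (X n * s) - p (x * s)) / (X n - x)))
        \<longlonglongrightarrow> (LBINT s:{0..1}. w s * (q (x * s) / x))"
    proof (rule weighted_integral_tendsto[OF w, where M = "M / a"])
      show "continuous_on {0..1} (\<lambda>s. (p (X n * s) - p (x * s)) / (X n - x))" for n
        using Xn[of n] x by (intro continuous_intros dilation_continuous[OF p]) auto
      show "continuous_on {0..1} (\<lambda>s. q (x * s) / x)"
        using x by (intro continuous_intros dilation_continuous[OF q(1)]) auto
      fix s :: real assume s: "s \<in> {0..1}"
      show "\<bar>(p (X n * s) - p (x * s)) / (X n - x)\<bar> \<le> M / a" for n
      proof -
        have "norm (p (X n * s) - p (x * s)) \<le> M / a * norm (X n - x)"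
        proof (rule field_differentiable_bound[where S = "{a<..<b}" and f = "\<lambda>y. p (y * s)"])
          show "((\<lambda>y. p (y * s)) has_real_derivative q (y * s) / y) (at y within {a<..<b})"
            if "y \<in> {a<..<b}" for y
            using pderiv[OF s that] by (rule has_field_derivative_at_within)
          show "norm (q (y * s) / y) \<le> M / a" if "y \<in> {a<..<b}" for y
            using dq[OF s that] by simp
        qed (use Xn[of n] ab in auto)
        with Xn[of n] show ?thesis by (simp add: abs_divide divide_le_eq)
      qed
      have "((\<lambda>y. (p (y * s) - p (x * s)) / (y - x)) \<longlongrightarrow> q (x * s) / x) (at x)"
        using pderiv[OF s, of x] ab by (simp add: has_field_derivative_iff)
      then show "(\<lambda>n. (p (X n * s) - p (x * s)) / (X n - x)) \<longlonglongrightarrow> q (x * s) / x"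
        using lim Xn(4) by (auto simp: tendsto_at_iff_sequentially comp_def)
    qed
    moreover have "(LBINT s:{0..1}. w s * ((p (X n * s) - p (x * s)) / (X n - x))) =
        (dilation_integral w p (X n) - dilation_integral w p x) / (X n - x)" for n
    proof -
      have "dilation_integral w p (X n) - dilation_integral w p x =
          (LBINT s:{0..1}. w s * p (X n * s) - w s * p (x * s))"
        unfolding dilation_integral_def using Xn[of n] x
        by (intro set_integral_diff(2)[symmetric] dilation_integrable[OF w p]) auto
      then show ?thesis
        by (simp flip: set_integral_divide_zero add: right_diff_distrib)
    qed
    moreover have "(LBINT s:{0..1}. w s * (q (x * s) / x)) = dilation_integral w q x / x"
      by (simp add: dilation_integral_def)
    ultimately show "((\<lambda>y. (dilation_integral w p y - dilation_integral w p x) / (y - x)) \<circ> X)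
        \<longlonglongrightarrow> dilation_integral w q x / x"
      by (simp only: comp_def)
  qed
  then show ?thesis
    using ab by (simp add: has_field_derivative_iff at_within_open[of x "{a<..<b}"])
qed


section \<open>Powers times averages are smooth\<close>

lemma powr_times_derivative:
  assumes "euler_derivative p p'" "t \<in> {0<..<1}"
  shows "((\<lambda>t. t powr a * p t) has_real_derivative t powr (a - 1) * (a * p t + p' t)) (at t)"
  using assms by (auto simp: euler_derivative_def powr_diff field_simps intro!: derivative_eq_intros)

text \<open>Differentiation preserves the shape \<open>x powr c * dilation_integral w p x\<close>; it lowers \<open>c\<close> by one
  and replaces \<open>p\<close> by \<open>c * p + \<theta> p\<close>.\<close>

lemma powr_times_dilation_derivative:
  assumes w: "set_integrable lborel {0..1} w"
    and p: "p \<in> euler_smooth" "euler_derivative p p'" and x: "x \<in> {0<..<1}"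
    and F: "\<And>y. y \<in> {0<..<1} \<Longrightarrow> F y = y powr c * dilation_integral w p y"
  shows "(F has_real_derivative
    x powr (c - 1) * dilation_integral w (\<lambda>t. c * p t + p' t) x) (at x)"
proof -
  have cont: "continuous_on {0..<1} p" "continuous_on {0..<1} p'"
    using p by (auto simp: euler_derivative_def intro: euler_smooth_continuous)
  have "(dilation_integral w p has_real_derivative dilation_integral w p' x / x) (at x)"
    using p x by (intro dilation_integral_derivative[OF w cont]) (auto simp: euler_derivative_def)
  then have "((\<lambda>y. y powr c * dilation_integral w p y) has_real_derivative
      x powr (c - 1) * (c * dilation_integral w p x + dilation_integral w p' x)) (at x)"
    using x by (auto simp: powr_diff field_simps intro!: derivative_eq_intros)
  also have "c * dilation_integral w p x + dilation_integral w p' x =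
      dilation_integral w (\<lambda>t. c * p t + p' t) x"
    using x by (intro dilation_integral_linear[symmetric] w cont) auto
  finally show ?thesis
    using x F by (elim has_field_derivative_transform_within_open[where S = "{0<..<1}"]) auto
qed

text \<open>By induction every iterated derivative has the shape
  \<open>x powr d * dilation_integral w q x\<close> with \<open>q\<close> in the ring.\<close>

lemma dilation_integral_smooth:
  assumes w: "set_integrable lborel {0..1} w" and p: "p \<in> euler_smooth"
    and F: "\<And>x. x \<in> {0<..<1} \<Longrightarrow> F x = x powr c * dilation_integral w p x"
  shows "infinitely_differentiable_on F {0<..<1}"
proof -
  have form: "\<exists>d. \<exists>q\<in>euler_smooth. \<forall>x\<in>{0<..<1}. (deriv ^^ n) F x = x powr d * dilation_integral w q x"
    for n
  proof (induction n)
    case 0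
    then show ?case using p F by auto
  next
    case (Suc n)
    then obtain d q where q: "q \<in> euler_smooth"
      and eq: "\<And>x. x \<in> {0<..<1} \<Longrightarrow> (deriv ^^ n) F x = x powr d * dilation_integral w q x"
      by blast
    obtain q' where q': "euler_derivative q q'"
      using euler_smooth_derivative[OF q] by blast
    have "(deriv ^^ Suc n) F x = x powr (d - 1) * dilation_integral w (\<lambda>t. d * q t + q' t) x"
      if "x \<in> {0<..<1}" for x
      using DERIV_imp_deriv[OF powr_times_dilation_derivative[OF w q q' that eq]] by simp
    moreover have "(\<lambda>t. d * q t + q' t) \<in> euler_smooth"
      using q q' by (intro euler_smooth.intros) (auto simp: euler_derivative_def)
    ultimately show ?case by blast
  qed
  show ?thesis
    unfolding infinitely_differentiable_on_def
  proof (intro allI ballI)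
    fix n and x :: real assume x: "x \<in> {0<..<1}"
    obtain d q where q: "q \<in> euler_smooth"
      and eq: "\<And>x. x \<in> {0<..<1} \<Longrightarrow> (deriv ^^ n) F x = x powr d * dilation_integral w q x"
      using form[of n] by blast
    obtain q' where q': "euler_derivative q q'"
      using euler_smooth_derivative[OF q] by blast
    show "(deriv ^^ n) F differentiable at x"
      using powr_times_dilation_derivative[OF w q q' x eq] by (auto simp: real_differentiable_def)
  qed
qed

section \<open>The Abel integral as an average over dilations\<close>

definition beta_weight :: "real \<Rightarrow> real \<Rightarrow> real" where
  "beta_weight \<gamma> s = s powr (\<gamma> - 1) * (1 - s) powr (\<gamma> - 1)"

lemma beta_weight_integrable: "\<gamma> > 0 \<Longrightarrow> set_integrable lborel {0..1} (beta_weight \<gamma>)"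
  unfolding beta_weight_def by (rule integrable_Beta)

lemma dilation_integral_beta_weight_0:
  assumes "\<gamma> > 0"
  shows "dilation_integral (beta_weight \<gamma>) p 0 = p 0 * Beta \<gamma> \<gamma>"
proof -
  have "(LBINT s:{0..1}. beta_weight \<gamma> s) = integral {0..1} (beta_weight \<gamma>)"
    using beta_weight_integrable[OF assms] by (rule set_borel_integral_eq_integral)
  also have "\<dots> = Beta \<gamma> \<gamma>"
    unfolding beta_weight_def using has_integral_Beta_real[OF assms assms] by (rule integral_unique)
  finally show ?thesis by (simp add: dilation_integral_def mult.commute)
qed

text \<open>The substitution \<open>t = x * s\<close>. It moves the end point \<open>x\<close> out of the kernel, so that no boundary
  singularity is left to differentiate.\<close>

lemma abel_integral:
  assumes g: "\<gamma> > 0" and x: "x \<in> {0<..<1}" and p: "continuous_on {0..<1} p"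
    and f: "\<And>t. t \<in> {0<..<1} \<Longrightarrow> f t = t powr (\<gamma> - 1) * p t"
  shows "set_integrable lborel {0<..<x} (\<lambda>t. (x - t) powr (\<gamma> - 1) * f t)" (is ?integrable)
    and "(LBINT t:{0<..<x}. (x - t) powr (\<gamma> - 1) * f t) =
      x powr (2 * \<gamma> - 1) * dilation_integral (beta_weight \<gamma>) p x" (is ?integral)
proof -
  define F where "F = (\<lambda>t. indicator {0<..<x} t *\<^sub>R ((x - t) powr (\<gamma> - 1) * f t))"
  define G where "G = (\<lambda>s. indicator {0..1} s *\<^sub>R (beta_weight \<gamma> s * p (x * s)))"
  have Fx: "F (0 + x * s) = x powr (2 * \<gamma> - 2) * G s" for s
  proof (cases "s \<in> {0<..<1}")
    case True
    with x have xs: "0 < x * s" "x * s < x" "x * s < 1"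
      by (auto simp: mult_less_cancel_left2 intro: less_trans[of _ x])
    have "x - x * s = x * (1 - s)" by (simp add: algebra_simps)
    moreover have "x powr (2 * \<gamma> - 2) = x powr (\<gamma> - 1) * x powr (\<gamma> - 1)"
      by (simp flip: powr_add)
    ultimately show ?thesis
      using True x xs by (simp add: F_def G_def beta_weight_def f powr_mult)
  next
    case False
    \<comment> \<open>At \<open>s = 0\<close> and \<open>s = 1\<close> the weight vanishes because \<open>0 powr a = 0\<close>.\<close>
    then show ?thesis
      using x by (auto simp: F_def G_def beta_weight_def indicator_def zero_less_mult_iff)
  qed
  have G: "integrable lborel G"
    using dilation_integrable[OF beta_weight_integrable[OF g] p, of x] x
    by (simp add: G_def set_integrable_def)
  then have "integrable lborel (\<lambda>s. F (0 + x * s))"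
    unfolding Fx by (rule integrable_mult_right)
  then have "integrable lborel F"
    using x by (subst (asm) lborel_integrable_real_affine_iff) auto
  then show ?integrable
    by (simp add: F_def set_integrable_def)
  have "integral\<^sup>L lborel F = \<bar>x\<bar> *\<^sub>R (\<integral>s. F (0 + x * s) \<partial>lborel)"
    using x by (intro lborel_integral_real_affine) auto
  also have "\<dots> = x powr (2 * \<gamma> - 1) * integral\<^sup>L lborel G"
    unfolding Fx using x by (simp add: powr_diff powr_numeral power2_eq_square)
  finally show ?integral
    by (simp add: F_def G_def dilation_integral_def set_lebesgue_integral_def)
qed

section \<open>The function of the theorem\<close>

text \<open>With \<open>u = t powr \<gamma>\<close> and \<open>v = (1 - t) powr \<gamma>\<close> the denominator is, by the law of cosines,
  the squared distance \<open>(u - v * cos (\<gamma> * \<pi>))\<^sup>2 + (v * sin (\<gamma> * \<pi>))\<^sup>2\<close>.\<close>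

lemma h_gam_denominator_pos:
  assumes "0 < \<gamma>" "\<gamma> < 1" "t \<in> {0..<1}"
  shows "(1 - t) powr (2 * \<gamma>) + t powr (2 * \<gamma>) - 2 * t powr \<gamma> * (1 - t) powr \<gamma> * cos (\<gamma> * pi) > 0"
proof -
  define u where "u = t powr \<gamma>"
  define v where "v = (1 - t) powr \<gamma>"
  have "v > 0" using assms by (simp add: v_def)
  have "sin (\<gamma> * pi) > 0" using assms by (intro sin_gt_zero) auto
  have "(1 - t) powr (2 * \<gamma>) + t powr (2 * \<gamma>) - 2 * t powr \<gamma> * (1 - t) powr \<gamma> * cos (\<gamma> * pi)
      = v\<^sup>2 + u\<^sup>2 - 2 * u * v * cos (\<gamma> * pi)"
    by (simp add: u_def v_def power2_eq_square flip: powr_add)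
  also have "\<dots> = (u - v * cos (\<gamma> * pi))\<^sup>2 + v\<^sup>2 * (1 - (cos (\<gamma> * pi))\<^sup>2)"
    by (simp add: power2_eq_square algebra_simps)
  also have "\<dots> = (u - v * cos (\<gamma> * pi))\<^sup>2 + (v * sin (\<gamma> * pi))\<^sup>2"
    by (simp add: power_mult_distrib flip: sin_squared_eq)
  also have "\<dots> > 0"
    using \<open>v > 0\<close> \<open>sin (\<gamma> * pi) > 0\<close> by (intro add_nonneg_pos) auto
  finally show ?thesis .
qed

text \<open>The denominator is a nonvanishing member of the ring, hence \<open>h_gam \<gamma> = t powr \<gamma> * U\<close> with \<open>U\<close> in
  the ring, and \<open>p = \<gamma> * U + \<theta> U\<close>. The denominator equals \<open>1\<close> at \<open>0\<close>, which gives \<open>p 0\<close>.\<close>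

lemma deriv_h_gam:
  assumes g: "0 < \<gamma>" "\<gamma> < 1"
  obtains p where "p \<in> euler_smooth"
    and "p 0 = sin (\<gamma> * pi) / pi * (\<gamma>\<^sup>2 / (1 - \<gamma>))"
    and "\<And>t. t \<in> {0<..<1} \<Longrightarrow> deriv (h_gam \<gamma>) t = t powr (\<gamma> - 1) * p t"
proof -
  define A where "A = sin (\<gamma> * pi) / pi * (\<gamma> / (1 - \<gamma>))"
  define D where "D = (\<lambda>t. (1 - t) powr (2 * \<gamma>) + t powr (2 * \<gamma>) +
    (- 2 * cos (\<gamma> * pi)) * (t powr \<gamma> * (1 - t) powr \<gamma>))"
  have D: "D t = (1 - t) powr (2 * \<gamma>) + t powr (2 * \<gamma>) -
      2 * t powr \<gamma> * (1 - t) powr \<gamma> * cos (\<gamma> * pi)" for t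
    by (simp add: D_def)
  define U where "U = (\<lambda>t. A * inverse (D t))"
  have "U \<in> euler_smooth"
    unfolding U_def
  proof (intro euler_smooth.mult euler_smooth.const euler_smooth.inverse)
    show "D \<in> euler_smooth"
      unfolding D_def using g by (intro euler_smooth.intros) auto
    show "D t \<noteq> 0" if "t \<in> {0..<1}" for t
      using h_gam_denominator_pos[OF g that] by (simp add: D)
  qed
  then obtain U' where U': "euler_derivative U U'"
    using euler_smooth_derivative by blast
  have h: "h_gam \<gamma> = (\<lambda>t. t powr \<gamma> * U t)"
    by (simp add: fun_eq_iff h_gam_def U_def A_def D divide_inverse)
  show thesis
  proof (rule that[of "\<lambda>t. \<gamma> * U t + U' t"])
    show "(\<lambda>t. \<gamma> * U t + U' t) \<in> euler_smooth"
      using U' \<open>U \<in> euler_smooth\<close> by (intro euler_smooth.intros) (auto simp: euler_derivative_def)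
    show "\<gamma> * U 0 + U' 0 = sin (\<gamma> * pi) / pi * (\<gamma>\<^sup>2 / (1 - \<gamma>))"
      using U' by (simp add: U_def A_def D_def euler_derivative_def power2_eq_square)
    show "deriv (h_gam \<gamma>) t = t powr (\<gamma> - 1) * (\<gamma> * U t + U' t)" if "t \<in> {0<..<1}" for t
      unfolding h by (intro DERIV_imp_deriv powr_times_derivative U' that)
  qed
qed

theorem theorem2p2:
  fixes \<gamma> :: real
  assumes "1 / 2 < \<gamma>" and "\<gamma> < 1"
  shows "infinitely_differentiable_on (H_gam \<gamma>) {0<..<1} \<and>
    (\<forall>x\<in>{0<..<1}.
       set_integrable lborel {0<..<x}
         (\<lambda>t. (x - t) powr (\<gamma> - 1) * (\<gamma> * deriv (h_gam \<gamma>) t + t * deriv (deriv (h_gam \<gamma>)) t)) \<and>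
       deriv (H_gam \<gamma>) x =
         1 / x * (LBINT t:{0<..<x}.
           (x - t) powr (\<gamma> - 1) * (\<gamma> * deriv (h_gam \<gamma>) t + t * deriv (deriv (h_gam \<gamma>)) t))) \<and>
    deriv (H_gam \<gamma>) \<sim>[at_right 0]
      (\<lambda>x. sin (\<gamma> * pi) / pi * ((Gamma (\<gamma> + 1))\<^sup>2 / Gamma (2 * \<gamma>)) *
            ((2 * \<gamma> - 1) / (1 - \<gamma>)) * x powr (2 * \<gamma> - 2))"
proof -
  have g: "0 < \<gamma>" "\<gamma> < 1" using assms by auto
  let ?w = "beta_weight \<gamma>"
  note w = beta_weight_integrable[OF g(1)]
  obtain p where p: "p \<in> euler_smooth"
    and p0: "p 0 = sin (\<gamma> * pi) / pi * (\<gamma>\<^sup>2 / (1 - \<gamma>))"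
    and dh: "\<And>t. t \<in> {0<..<1} \<Longrightarrow> deriv (h_gam \<gamma>) t = t powr (\<gamma> - 1) * p t"
    using deriv_h_gam[OF g] by blast
  obtain p' where p': "euler_derivative p p'"
    using euler_smooth_derivative[OF p] by blast
  define q where "q = (\<lambda>t. (2 * \<gamma> - 1) * p t + p' t)"
  have "q \<in> euler_smooth"
    unfolding q_def using p p' by (intro euler_smooth.intros) (auto simp: euler_derivative_def)
  then have q: "continuous_on {0..<1} q" by (rule euler_smooth_continuous)

  have H: "H_gam \<gamma> x = x powr (2 * \<gamma> - 1) * dilation_integral ?w p x" if "x \<in> {0<..<1}" for x
    unfolding H_gam_def
    by (rule abel_integral(2)[OF g(1) that euler_smooth_continuous[OF p] dh])
  have dH: "deriv (H_gam \<gamma>) x = x powr (2 * \<gamma> - 2) * dilation_integral ?w q x"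
    if "x \<in> {0<..<1}" for x
    using DERIV_imp_deriv[OF powr_times_dilation_derivative[OF w p p' that H]]
    by (simp add: q_def)

  have ddh: "deriv (deriv (h_gam \<gamma>)) t = t powr (\<gamma> - 2) * ((\<gamma> - 1) * p t + p' t)"
    if "t \<in> {0<..<1}" for t
  proof -
    have "((\<lambda>t. t powr (\<gamma> - 1) * p t) has_real_derivative
        t powr (\<gamma> - 1 - 1) * ((\<gamma> - 1) * p t + p' t)) (at t)"
      by (rule powr_times_derivative[OF p' that])
    then have "(deriv (h_gam \<gamma>) has_real_derivative
        t powr (\<gamma> - 1 - 1) * ((\<gamma> - 1) * p t + p' t)) (at t)"
      using that dh by (elim has_field_derivative_transform_within_open[where S = "{0<..<1}"]) auto
    then show ?thesis by (simp add: DERIV_imp_deriv)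
  qed
  have integrand: "\<gamma> * deriv (h_gam \<gamma>) t + t * deriv (deriv (h_gam \<gamma>)) t = t powr (\<gamma> - 1) * q t"
    if "t \<in> {0<..<1}" for t
  proof -
    have "t * t powr (\<gamma> - 2) = t powr (\<gamma> - 1)"
      using that by (simp add: powr_mult_base)
    then have "t * deriv (deriv (h_gam \<gamma>)) t = t powr (\<gamma> - 1) * ((\<gamma> - 1) * p t + p' t)"
      unfolding ddh[OF that] by (simp flip: mult.assoc)
    then show ?thesis
      using that by (simp add: dh q_def algebra_simps)
  qed

  let ?C = "sin (\<gamma> * pi) / pi * ((Gamma (\<gamma> + 1))\<^sup>2 / Gamma (2 * \<gamma>)) * ((2 * \<gamma> - 1) / (1 - \<gamma>))"
  have "sin (\<gamma> * pi) > 0" using g by (intro sin_gt_zero) auto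
  moreover have "Gamma (\<gamma> + 1) \<noteq> 0" "Gamma (2 * \<gamma>) \<noteq> 0"
    using g Gamma_real_pos[of "\<gamma> + 1"] Gamma_real_pos[of "2 * \<gamma>"] by linarith+
  ultimately have C: "?C \<noteq> 0" using assms by auto
  have "q 0 * Beta \<gamma> \<gamma> = ?C"
  proof -
    have "Gamma (\<gamma> + 1) = \<gamma> * Gamma \<gamma>"
      using g by (intro Gamma_plus1) (auto elim!: nonpos_Ints_cases)
    then show ?thesis
      using p' by (simp add: q_def p0 euler_derivative_def Beta_def power2_eq_square mult_ac)
  qed
  moreover have "(dilation_integral ?w q \<longlongrightarrow> dilation_integral ?w q 0) (at_right 0)"
  proof -
    have "continuous_on {0..1/2} (dilation_integral ?w q)"
      by (rule dilation_integral_continuous[OF w q]) simp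
    then have "(dilation_integral ?w q \<longlongrightarrow> dilation_integral ?w q 0) (at 0 within {0..1/2})"
      unfolding continuous_on by (rule bspec) simp
    also have "at 0 within {0..1/2} = at_right (0::real)"
      by (rule at_within_Icc_at_right) simp
    finally show ?thesis .
  qed
  ultimately have lim: "(dilation_integral ?w q \<longlongrightarrow> ?C) (at_right 0)"
    by (simp add: dilation_integral_beta_weight_0[OF g(1)])
  have "((\<lambda>x. deriv (H_gam \<gamma>) x / (?C * x powr (2 * \<gamma> - 2))) \<longlongrightarrow> 1) (at_right 0)"
  proof (rule Lim_transform_eventually)
    show "((\<lambda>x. dilation_integral ?w q x / ?C) \<longlongrightarrow> 1) (at_right 0)"
      using tendsto_divide[OF lim tendsto_const C] C by simp
    have "\<forall>\<^sub>F x in at_right 0. x \<in> {0<..<1::real}"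
      by (rule eventually_at_right_real) simp
    then show "\<forall>\<^sub>F x in at_right 0.
        dilation_integral ?w q x / ?C = deriv (H_gam \<gamma>) x / (?C * x powr (2 * \<gamma> - 2))"
    proof eventually_elim
      case (elim x)
      then show ?case by (subst dH) auto
    qed
  qed
  then have asymp: "deriv (H_gam \<gamma>) \<sim>[at_right 0] (\<lambda>x. ?C * x powr (2 * \<gamma> - 2))"
    by (rule asymp_equivI')

  have "set_integrable lborel {0<..<x}
         (\<lambda>t. (x - t) powr (\<gamma> - 1) * (\<gamma> * deriv (h_gam \<gamma>) t + t * deriv (deriv (h_gam \<gamma>)) t)) \<and>
       deriv (H_gam \<gamma>) x =
         1 / x * (LBINT t:{0<..<x}.
           (x - t) powr (\<gamma> - 1) * (\<gamma> * deriv (h_gam \<gamma>) t + t * deriv (deriv (h_gam \<gamma>)) t))"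
    if x: "x \<in> {0<..<1}" for x
  proof -
    have "x powr (2 * \<gamma> - 2) = 1 / x * x powr (2 * \<gamma> - 1)"
      using x by (simp add: powr_diff powr_numeral power2_eq_square)
    then show ?thesis
      using abel_integral[OF g(1) x q integrand] dH[OF x] by simp
  qed
  then show ?thesis
    using dilation_integral_smooth[OF w p H] asymp by blast
qed

end
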